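(* Let $R$ be an infinite integral domain that is not homomorphically finite. Then there does not exist an ultrafilter $p\in\beta R$ such that every $A\in p$ is a central subset of $(R,+)$ and a central subset of $(R\setminus\{0\},\cdot)$.
   Context: A ring $R$ is homomorphically finite if for every $r\in R\setminus\{0\}$ the two-sided ideal generated by $r$ is a finite index subgroup of $(R,+)$. Integral domains are commutative and, in the paper, rings are not required to have a multiplicative unit. For a set $S$, $\beta S$ is the set of ultrafilters on $S$. For a semigroup $(S,\diamond)$, the operation extends to $\beta S$ by: $A\in p\diamond q$ iff $\{s\in S : s^{-1}A\in q\}\in p$, where $s^{-1}A=\{x\in S : s\diamond x\in A\}$; this makes $\beta S$ a compact right topological semigroup (topology with basis $\{p\in\beta S : A\in p\}$, $A\subseteq S$), which has a smallest two-sided ideal $K(\beta S,\diamond)$. $E(K(\beta S,\diamond))$ is the set of idempotents in $K(\beta S,\diamond)$. A set $A\subseteq S$ is central in $(S,\diamond)$ if $A\in q$ for some $q\in E(K(\beta S,\diamond))$. Ultrafilters on $R\setminus\{0\}$ are identified with ultrafilters on $R$ other than the principal one at $0$; accordingly a set $A\subseteq R$ is called central in $(R\setminus\{0\},\cdot)$ if $A\setminus\{0\}$ is. *)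

theory Defs
  imports Main
begin

text \<open>
  Non-unital rings are the type classes \<open>ring\<close> and \<open>comm_ring\<close>, neither of which
  provides a unit.
\<close>

definition two_sided_ideal :: "'a::ring set \<Rightarrow> bool" where
  "two_sided_ideal I \<longleftrightarrow>
     0 \<in> I \<and> (\<forall>x\<in>I. \<forall>y\<in>I. x + y \<in> I) \<and> (\<forall>x\<in>I. - x \<in> I) \<and>
     (\<forall>x\<in>I. \<forall>r. r * x \<in> I \<and> x * r \<in> I)"

text \<open>
  In the absence of a unit this ideal is in general larger than the set of finite sums of
  elements \<open>s * r * t\<close>; the intersection always contains \<open>r\<close> itself.
\<close>

definition ideal_generated :: "'a::ring \<Rightarrow> 'a set" where
  "ideal_generated r = \<Inter>{I. two_sided_ideal I \<and> r \<in> I}"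

definition finite_index :: "'a::ab_group_add set \<Rightarrow> bool" where
  "finite_index H \<longleftrightarrow> finite (range (\<lambda>x. (+) x ` H))"

definition homomorphically_finite :: "'a::ring itself \<Rightarrow> bool" where
  "homomorphically_finite _ \<longleftrightarrow> (\<forall>r::'a. r \<noteq> 0 \<longrightarrow> finite_index (ideal_generated r))"

text \<open>
  Semigroups are given by a carrier \<open>S\<close> and an operation \<open>f\<close>. An ultrafilter on \<open>S\<close> is a
  family of subsets of \<open>S\<close>.
\<close>

definition ultrafilter_on :: "'a set \<Rightarrow> 'a set set \<Rightarrow> bool" where
  "ultrafilter_on S p \<longleftrightarrow>
     p \<subseteq> Pow S \<and> S \<in> p \<and> {} \<notin> p \<and>
     (\<forall>A\<in>p. \<forall>B\<in>p. A \<inter> B \<in> p) \<and>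
     (\<forall>A\<in>p. \<forall>B. A \<subseteq> B \<and> B \<subseteq> S \<longrightarrow> B \<in> p) \<and>
     (\<forall>A. A \<subseteq> S \<longrightarrow> A \<in> p \<or> S - A \<in> p)"

definition beta :: "'a set \<Rightarrow> 'a set set set" where
  "beta S = {p. ultrafilter_on S p}"

definition beta_op ::
    "'a set \<Rightarrow> ('a \<Rightarrow> 'a \<Rightarrow> 'a) \<Rightarrow> 'a set set \<Rightarrow> 'a set set \<Rightarrow> 'a set set" where
  "beta_op S f p q = {A. A \<subseteq> S \<and> {s \<in> S. {x \<in> S. f s x \<in> A} \<in> q} \<in> p}"

definition beta_ideal :: "'a set \<Rightarrow> ('a \<Rightarrow> 'a \<Rightarrow> 'a) \<Rightarrow> 'a set set set \<Rightarrow> bool" where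
  "beta_ideal S f I \<longleftrightarrow>
     I \<noteq> {} \<and> I \<subseteq> beta S \<and>
     (\<forall>p\<in>beta S. \<forall>q\<in>I. beta_op S f p q \<in> I \<and> beta_op S f q p \<in> I)"

text \<open>
  The smallest two-sided ideal, rendered as the intersection of all two-sided ideals.
\<close>

definition K_beta :: "'a set \<Rightarrow> ('a \<Rightarrow> 'a \<Rightarrow> 'a) \<Rightarrow> 'a set set set" where
  "K_beta S f = \<Inter>{I. beta_ideal S f I}"

lemma K_beta_eqI:
  assumes "beta_ideal S f M" and "\<And>I. beta_ideal S f I \<Longrightarrow> M \<subseteq> I"
  shows "K_beta S f = M"
  using assms unfolding K_beta_def by blast

definition EK_beta :: "'a set \<Rightarrow> ('a \<Rightarrow> 'a \<Rightarrow> 'a) \<Rightarrow> 'a set set set" where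
  "EK_beta S f = {q \<in> K_beta S f. beta_op S f q q = q}"

definition central :: "'a set \<Rightarrow> ('a \<Rightarrow> 'a \<Rightarrow> 'a) \<Rightarrow> 'a set \<Rightarrow> bool" where
  "central S f A \<longleftrightarrow> (\<exists>q\<in>EK_beta S f. A \<in> q)"

end

theory Submission
  imports Defs
begin

text \<open>
  Choose \<open>r \<noteq> 0\<close> whose generated ideal \<open>H\<close> has infinite index in \<open>(R, +)\<close>. Then \<open>H\<close> is
  multiplicatively unavoidable and additively negligible, and an ultrafilter as in the theorem
  can contain neither \<open>H\<close> nor its complement.

  Both halves rest on one principle: \<open>K(\<beta>S)\<close> lies inside every two-sided ideal of \<open>\<beta>S\<close>, so
  a property holds throughout \<open>K(\<beta>S)\<close> as soon as the ultrafilters having it form an ideal.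

  For multiplication, \<open>H - {0}\<close> is an ideal of the semigroup \<open>R - {0}\<close>, because there are no
  zero divisors. Hence the ultrafilters containing \<open>H - {0}\<close> form an ideal of
  \<open>\<beta>(R - {0})\<close>, every ultrafilter in \<open>K\<close> contains \<open>H - {0}\<close>, and the complement of \<open>H\<close> is
  not central (lemma \<open>K_beta_contains_ideal\<close>).

  For addition, the ultrafilters that contain no coset of \<open>H\<close> form an ideal of \<open>\<beta>R\<close>. Infinite
  index is exactly what makes this ideal nonempty: finitely many cosets do not cover \<open>R\<close>, so
  some ultrafilter contains the complements of all cosets. Hence no ultrafilter in \<open>K\<close> contains
  \<open>H\<close>, and \<open>H\<close> is not central (lemma \<open>K_beta_avoids_infinite_index\<close>).
\<close>

section \<open>Ultrafilters\<close>

lemma ultrafilter_on_Int_iff: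
  assumes "ultrafilter_on S p" "A \<subseteq> S" "B \<subseteq> S"
  shows "A \<inter> B \<in> p \<longleftrightarrow> A \<in> p \<and> B \<in> p"
  using assms unfolding ultrafilter_on_def by (metis Int_lower1 Int_lower2)

lemma ultrafilter_on_mono:
  assumes "ultrafilter_on S p" "A \<in> p" "A \<subseteq> B" "B \<subseteq> S"
  shows "B \<in> p"
  using assms unfolding ultrafilter_on_def by blast

lemma ultrafilter_on_disjoint:
  assumes "ultrafilter_on S p" "A \<in> p" "B \<in> p"
  shows "A \<inter> B \<noteq> {}"
  using assms unfolding ultrafilter_on_def by metis

lemma ultrafilter_on_Diff_iff:
  assumes "ultrafilter_on S p" "A \<subseteq> S"
  shows "S - A \<in> p \<longleftrightarrow> A \<notin> p"
  using assms ultrafilter_on_disjoint[OF assms(1), of A "S - A"]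
  unfolding ultrafilter_on_def by blast

lemma ultrafilter_on_principal:
  assumes "a \<in> S"
  shows "ultrafilter_on S {A. A \<subseteq> S \<and> a \<in> A}"
  using assms unfolding ultrafilter_on_def by auto

text \<open>
  A family with the finite intersection property that is maximal under inclusion is an
  ultrafilter: it absorbs any set that meets all its finite intersections. Zorn's lemma supplies
  a maximal family, since a finite subfamily of the union of a chain lies in one member.
\<close>

lemma ultrafilter_on_extends:
  assumes C: "C \<subseteq> Pow S"
    and fip: "\<And>F. finite F \<Longrightarrow> F \<subseteq> C \<Longrightarrow> S \<inter> \<Inter>F \<noteq> {}"
  shows "\<exists>p. ultrafilter_on S p \<and> C \<subseteq> p"
proof -
  define FIP where "FIP = {G. C \<subseteq> G \<and> G \<subseteq> Pow S \<and> (\<forall>F. finite F \<longrightarrow> F \<subseteq> G \<longrightarrow> S \<inter> \<Inter>F \<noteq> {})}"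
  have "\<exists>M\<in>FIP. \<forall>X\<in>FIP. M \<subseteq> X \<longrightarrow> X = M"
  proof (rule subset_Zorn_nonempty)
    show "FIP \<noteq> {}" using C fip unfolding FIP_def by blast
  next
    fix \<C> assume ne: "\<C> \<noteq> {}" and ch: "subset.chain FIP \<C>"
    then have sub: "\<C> \<subseteq> FIP" by (simp add: subset.chain_def)
    have "S \<inter> \<Inter>F \<noteq> {}" if F: "finite F" "F \<subseteq> \<Union>\<C>" for F
    proof -
      obtain G where "G \<in> \<C>" "F \<subseteq> G"
        using finite_subset_Union_chain[OF F ne ch] by blast
      then show ?thesis using sub F(1) unfolding FIP_def by blast
    qed
    moreover have "C \<subseteq> \<Union>\<C>" "\<Union>\<C> \<subseteq> Pow S"
      using sub ne by (fastforce simp: FIP_def)+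
    ultimately show "\<Union>\<C> \<in> FIP" by (simp add: FIP_def)
  qed
  then obtain M where M: "M \<in> FIP" and max: "\<And>X. X \<in> FIP \<Longrightarrow> M \<subseteq> X \<Longrightarrow> X = M" by blast
  have CM: "C \<subseteq> M" and MS: "M \<subseteq> Pow S"
    and Mfip: "\<And>F. finite F \<Longrightarrow> F \<subseteq> M \<Longrightarrow> S \<inter> \<Inter>F \<noteq> {}"
    using M unfolding FIP_def by auto
  have absorb: "A \<in> M" if A: "A \<subseteq> S" and meets: "\<And>F. finite F \<Longrightarrow> F \<subseteq> M \<Longrightarrow> A \<inter> \<Inter>F \<noteq> {}" for A
  proof -
    have "S \<inter> \<Inter>F \<noteq> {}" if F: "finite F" "F \<subseteq> insert A M" for F
    proof -
      have "A \<inter> \<Inter>(F - {A}) \<noteq> {}" using meets[of "F - {A}"] F by blast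
      then show ?thesis using A by blast
    qed
    moreover have "C \<subseteq> insert A M" "insert A M \<subseteq> Pow S" using A CM MS by auto
    ultimately have "insert A M \<in> FIP" by (simp only: FIP_def mem_Collect_eq) simp
    then show ?thesis using max[of "insert A M"] by blast
  qed
  have separated: "\<exists>F. finite F \<and> F \<subseteq> M \<and> A \<inter> \<Inter>F = {}" if A: "A \<subseteq> S" "A \<notin> M" for A
  proof (rule ccontr)
    assume "\<not> ?thesis"
    then have "A \<in> M" by (intro absorb A(1)) simp
    then show False using A(2) by contradiction
  qed
  have "ultrafilter_on S M"
    unfolding ultrafilter_on_def
  proof (intro conjI ballI allI impI)
    show "M \<subseteq> Pow S" by (fact MS)
    show "S \<in> M" using absorb[of S] Mfip by blast
    show "{} \<notin> M" using Mfip[of "{{}}"] by auto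
  next
    fix A B assume AB: "A \<in> M" "B \<in> M"
    show "A \<inter> B \<in> M"
    proof (rule absorb)
      show "A \<inter> B \<subseteq> S" using AB MS by blast
      fix F assume "finite F" "F \<subseteq> M"
      then have "S \<inter> \<Inter>(insert A (insert B F)) \<noteq> {}" using AB by (intro Mfip) auto
      then show "A \<inter> B \<inter> \<Inter>F \<noteq> {}" by blast
    qed
  next
    fix A B assume AB: "A \<in> M" "A \<subseteq> B \<and> B \<subseteq> S"
    show "B \<in> M"
    proof (rule absorb)
      show "B \<subseteq> S" using AB by blast
      fix F assume "finite F" "F \<subseteq> M"
      then have "S \<inter> \<Inter>(insert A F) \<noteq> {}" using AB by (intro Mfip) auto
      moreover have "S \<inter> \<Inter>(insert A F) \<subseteq> B \<inter> \<Inter>F" using AB(2) by auto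
      ultimately show "B \<inter> \<Inter>F \<noteq> {}" by (metis subset_empty)
    qed
  next
    fix A assume A: "A \<subseteq> S"
    show "A \<in> M \<or> S - A \<in> M"
    proof (rule ccontr)
      assume neg: "\<not> (A \<in> M \<or> S - A \<in> M)"
      then have "A \<notin> M" "S - A \<notin> M" by simp_all
      obtain F where F: "finite F" "F \<subseteq> M" "A \<inter> \<Inter>F = {}"
        using separated[OF A \<open>A \<notin> M\<close>] by (elim exE conjE)
      obtain G where G: "finite G" "G \<subseteq> M" "(S - A) \<inter> \<Inter>G = {}"
        using separated[OF Diff_subset \<open>S - A \<notin> M\<close>] by (elim exE conjE)
      have "S \<inter> \<Inter>(F \<union> G) \<noteq> {}" using F G by (intro Mfip) auto
      then show False using F(3) G(3) by blast
    qed
  qed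
  then show ?thesis using CM by blast
qed

section \<open>Ideals of the semigroup of ultrafilters\<close>

lemma ultrafilter_on_beta_op:
  assumes p: "ultrafilter_on S p" and q: "ultrafilter_on S q"
    and f: "\<And>s x. s \<in> S \<Longrightarrow> x \<in> S \<Longrightarrow> f s x \<in> S"
  shows "ultrafilter_on S (beta_op S f p q)"
proof -
  define T where "T s A = {x \<in> S. f s x \<in> A}" for s A
  define D where "D A = {s \<in> S. T s A \<in> q}" for A
  have op: "beta_op S f p q = {A. A \<subseteq> S \<and> D A \<in> p}"
    by (simp add: beta_op_def D_def T_def)
  have TS: "T s A \<subseteq> S" for s A by (auto simp: T_def)
  have DS: "D A \<subseteq> S" for A by (auto simp: D_def)
  have "T s S = S" if "s \<in> S" for s using f that by (auto simp: T_def)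
  then have D_S: "D S = S" using q by (auto simp: D_def ultrafilter_on_def)
  have D_empty: "D {} = {}" using q by (auto simp: D_def T_def ultrafilter_on_def)
  have "T s (A \<inter> B) = T s A \<inter> T s B" for s A B by (auto simp: T_def)
  then have D_Int: "D (A \<inter> B) = D A \<inter> D B" for A B
    by (auto simp: D_def ultrafilter_on_Int_iff[OF q TS TS])
  have D_mono: "D A \<subseteq> D B" if "A \<subseteq> B" for A B
  proof -
    have "A \<inter> B = A" using that by blast
    then show ?thesis using D_Int[of A B] by auto
  qed
  have "T s (S - A) = S - T s A" if "s \<in> S" for s A
    using f that by (auto simp: T_def)
  then have D_Diff: "D (S - A) = S - D A" for A
    by (auto simp: D_def ultrafilter_on_Diff_iff[OF q TS])
  show ?thesis
    unfolding op ultrafilter_on_def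
  proof (intro conjI ballI allI impI)
    show "{A. A \<subseteq> S \<and> D A \<in> p} \<subseteq> Pow S" by blast
    show "S \<in> {A. A \<subseteq> S \<and> D A \<in> p}" using p by (simp add: D_S ultrafilter_on_def)
    show "{} \<notin> {A. A \<subseteq> S \<and> D A \<in> p}" using p by (simp add: D_empty ultrafilter_on_def)
  next
    fix A B assume "A \<in> {A. A \<subseteq> S \<and> D A \<in> p}" "B \<in> {A. A \<subseteq> S \<and> D A \<in> p}"
    then show "A \<inter> B \<in> {A. A \<subseteq> S \<and> D A \<in> p}"
      using ultrafilter_on_Int_iff[OF p DS DS] by (auto simp: D_Int)
  next
    fix A B assume "A \<in> {A. A \<subseteq> S \<and> D A \<in> p}" "A \<subseteq> B \<and> B \<subseteq> S"
    then show "B \<in> {A. A \<subseteq> S \<and> D A \<in> p}"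
      using ultrafilter_on_mono[OF p _ D_mono DS] by blast
  next
    fix A assume "A \<subseteq> S"
    then show "A \<in> {A. A \<subseteq> S \<and> D A \<in> p} \<or> S - A \<in> {A. A \<subseteq> S \<and> D A \<in> p}"
      using ultrafilter_on_Diff_iff[OF p DS] by (auto simp: D_Diff)
  qed
qed

text \<open>
  If \<open>s \<in> L\<close>, then \<open>s\<inverse>L\<close> is all of \<open>S\<close>; if \<open>s\<close> is arbitrary, then \<open>s\<inverse>L\<close> contains \<open>L\<close>. So
  a product of two ultrafilters contains \<open>L\<close> as soon as one of the factors does, and the closure
  of \<open>L\<close> in \<open>\<beta>S\<close> is an ideal.
\<close>

lemma K_beta_contains_ideal:
  assumes f: "\<And>s x. s \<in> S \<Longrightarrow> x \<in> S \<Longrightarrow> f s x \<in> S"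
    and L: "L \<subseteq> S" "L \<noteq> {}"
    and left: "\<And>s x. s \<in> S \<Longrightarrow> x \<in> L \<Longrightarrow> f s x \<in> L"
    and right: "\<And>s x. s \<in> L \<Longrightarrow> x \<in> S \<Longrightarrow> f s x \<in> L"
    and q: "q \<in> K_beta S f"
  shows "ultrafilter_on S q \<and> L \<in> q"
proof -
  define J where "J = {q. ultrafilter_on S q \<and> L \<in> q}"
  have "beta_ideal S f J"
    unfolding beta_ideal_def
  proof (intro conjI ballI)
    obtain a where "a \<in> L" using L by blast
    then have "{A. A \<subseteq> S \<and> a \<in> A} \<in> J"
      using L ultrafilter_on_principal[of a S] by (auto simp: J_def)
    then show "J \<noteq> {}" by blast
    show "J \<subseteq> beta S" by (auto simp: J_def beta_def)
  next
    fix p q assume "p \<in> beta S" "q \<in> J"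
    then have p: "ultrafilter_on S p" and q: "ultrafilter_on S q" "L \<in> q"
      by (auto simp: J_def beta_def)
    have "{x \<in> S. f s x \<in> L} \<in> q" if "s \<in> S" for s
      by (rule ultrafilter_on_mono[OF q]) (use left L that in auto)
    then have "{s \<in> S. {x \<in> S. f s x \<in> L} \<in> q} = S" by blast
    then have "L \<in> beta_op S f p q"
      using p L by (simp add: beta_op_def ultrafilter_on_def)
    then show "beta_op S f p q \<in> J"
      using ultrafilter_on_beta_op[OF p q(1) f] by (simp add: J_def)
    have "{x \<in> S. f s x \<in> L} \<in> p" if "s \<in> L" for s
    proof -
      have "{x \<in> S. f s x \<in> L} = S" using right that by blast
      then show ?thesis using p by (simp add: ultrafilter_on_def)
    qed
    then have "{s \<in> S. {x \<in> S. f s x \<in> L} \<in> p} \<in> q"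
      by (intro ultrafilter_on_mono[OF q]) (use L in auto)
    then have "L \<in> beta_op S f q p"
      using L by (simp add: beta_op_def)
    then show "beta_op S f q p \<in> J"
      using ultrafilter_on_beta_op[OF q(1) p f] by (simp add: J_def)
  qed
  then show ?thesis using q unfolding K_beta_def J_def by blast
qed

section \<open>Subgroups of infinite index\<close>

lemma mem_coset_iff:
  fixes x y :: "'a::ab_group_add"
  shows "y \<in> (+) x ` H \<longleftrightarrow> y - x \<in> H"
proof
  show "y - x \<in> H \<Longrightarrow> y \<in> (+) x ` H" by (rule image_eqI[of _ _ "y - x"]) simp_all
qed auto

lemma cosets_eq_if_meet:
  fixes H :: "'a::ab_group_add set"
  assumes add: "\<And>x y. x \<in> H \<Longrightarrow> y \<in> H \<Longrightarrow> x + y \<in> H"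
    and minus: "\<And>x. x \<in> H \<Longrightarrow> - x \<in> H"
    and z: "z \<in> (+) x ` H" "z \<in> (+) y ` H"
  shows "(+) x ` H = (+) y ` H"
proof -
  have *: "(+) x ` H \<subseteq> (+) y ` H" if "z - x \<in> H" "z - y \<in> H" for x y
  proof
    fix w assume "w \<in> (+) x ` H"
    then have "(w - x) + (- (z - x) + (z - y)) \<in> H"
      using that by (intro add minus) (simp_all only: mem_coset_iff)
    then show "w \<in> (+) y ` H" by (simp add: mem_coset_iff)
  qed
  show ?thesis using * z by (intro subset_antisym) (simp_all only: mem_coset_iff)
qed

text \<open>
  The ideal at work consists of the ultrafilters that contain no coset of \<open>H\<close>, that is, those whose
  image in \<open>\<beta>(G/H)\<close>, for \<open>G\<close> the ambient group, is nonprincipal. A translate of a coset is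
  a coset, so \<open>p + q\<close> avoids all cosets if \<open>q\<close> does. In \<open>q + p\<close> the roles differ: there the
  point is that two distinct cosets are disjoint, so \<open>p\<close> contains at most one of them.
\<close>

lemma K_beta_avoids_infinite_index:
  fixes H :: "'a::ab_group_add set"
  assumes zero: "0 \<in> H"
    and add: "\<And>x y. x \<in> H \<Longrightarrow> y \<in> H \<Longrightarrow> x + y \<in> H"
    and minus: "\<And>x. x \<in> H \<Longrightarrow> - x \<in> H"
    and index: "\<not> finite_index H"
    and q: "q \<in> K_beta UNIV (+)"
  shows "H \<notin> q"
proof -
  have coset_eq: "(+) x ` H = (+) y ` H" if "z \<in> (+) x ` H" "z \<in> (+) y ` H" for x y z
    using cosets_eq_if_meet[of H z x y] add minus that by blast
  have self: "x \<in> (+) x ` H" for x using zero by (simp add: mem_coset_iff)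
  define I where "I = {q. ultrafilter_on UNIV q \<and> (\<forall>x. (+) x ` H \<notin> q)}"
  have "beta_ideal UNIV (+) I"
    unfolding beta_ideal_def
  proof (intro conjI ballI)
    have "\<exists>q. ultrafilter_on UNIV q \<and> range (\<lambda>x. - ((+) x ` H)) \<subseteq> q"
    proof (rule ultrafilter_on_extends)
      fix F assume F: "finite F" "F \<subseteq> range (\<lambda>x. - ((+) x ` H))"
      then obtain X where X: "finite X" "F = (\<lambda>x. - ((+) x ` H)) ` X"
        using finite_subset_image[OF F] by auto
      show "UNIV \<inter> \<Inter>F \<noteq> {}"
      proof
        assume "UNIV \<inter> \<Inter>F = {}"
        then have "y \<notin> \<Inter>F" for y by simp
        then have cover: "\<exists>x\<in>X. y \<in> (+) x ` H" for y
          unfolding X(2) by (simp only: INT_iff Compl_iff) blast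
        have "range (\<lambda>x. (+) x ` H) \<subseteq> (\<lambda>x. (+) x ` H) ` X"
        proof (rule image_subsetI)
          fix y
          obtain x where "x \<in> X" "y \<in> (+) x ` H" using cover by blast
          then show "(+) y ` H \<in> (\<lambda>x. (+) x ` H) ` X"
            using coset_eq[OF self, of y x] by blast
        qed
        then show False
          using index X(1) unfolding finite_index_def by (blast intro: finite_surj)
      qed
    qed simp
    then obtain q where "ultrafilter_on UNIV q" "\<And>x. UNIV - ((+) x ` H) \<in> q"
      by (auto simp: Compl_eq_Diff_UNIV)
    then have "q \<in> I" using ultrafilter_on_Diff_iff[of UNIV q] by (simp add: I_def)
    then show "I \<noteq> {}" by blast
    show "I \<subseteq> beta UNIV" by (auto simp: I_def beta_def)
  next
    fix p q assume "p \<in> beta (UNIV :: 'a set)" "q \<in> I"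
    then have p: "ultrafilter_on UNIV p" and q: "ultrafilter_on UNIV q"
      and avoid: "\<And>x. (+) x ` H \<notin> q"
      by (auto simp: I_def beta_def)
    have translate: "{y. s + y \<in> (+) x ` H} = (+) (x - s) ` H" for s x
      by (auto simp only: mem_coset_iff mem_Collect_eq) (simp_all add: algebra_simps)
    have "(+) x ` H \<notin> beta_op UNIV (+) p q" for x
      using p avoid by (simp add: beta_op_def translate ultrafilter_on_def)
    then show "beta_op UNIV (+) p q \<in> I"
      using ultrafilter_on_beta_op[OF p q] by (simp add: I_def)
    have "(+) x ` H \<notin> beta_op UNIV (+) q p" for x
    proof
      assume "(+) x ` H \<in> beta_op UNIV (+) q p"
      then have D: "{s. (+) (x - s) ` H \<in> p} \<in> q" (is "?D \<in> q")
        by (simp add: beta_op_def translate)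
      then have "?D \<noteq> {}" using ultrafilter_on_disjoint[OF q D D] by blast
      then obtain t where t: "(+) (x - t) ` H \<in> p" by blast
      \<comment> \<open>Both \<open>(x - s) + H\<close> and \<open>(x - t) + H\<close> belong to \<open>p\<close>, so they meet and coincide.\<close>
      have "?D \<subseteq> (+) t ` H"
      proof
        fix s assume "s \<in> ?D"
        then have "(+) (x - s) ` H \<in> p" by simp
        then obtain z where "z \<in> (+) (x - s) ` H" "z \<in> (+) (x - t) ` H"
          using ultrafilter_on_disjoint[OF p _ t] by (meson disjoint_iff)
        then have "x - t \<in> (+) (x - s) ` H" using coset_eq self[of "x - t"] by metis
        then show "s \<in> (+) t ` H" by (simp only: mem_coset_iff) (simp add: algebra_simps)
      qed
      then have "(+) t ` H \<in> q" by (rule ultrafilter_on_mono[OF q D _ subset_UNIV])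
      then show False using avoid by simp
    qed
    then show "beta_op UNIV (+) q p \<in> I"
      using ultrafilter_on_beta_op[OF q p] by (simp add: I_def)
  qed
  then have "(+) 0 ` H \<notin> q" using q unfolding K_beta_def I_def by blast
  then show ?thesis by simp
qed

section \<open>Additive and multiplicative centrality are incompatible\<close>

lemma two_sided_ideal_ideal_generated: "two_sided_ideal (ideal_generated r)"
  unfolding ideal_generated_def two_sided_ideal_def by blast

lemma in_ideal_generated: "r \<in> ideal_generated r"
  unfolding ideal_generated_def by blast

theorem corollary8:
  assumes "infinite (UNIV :: 'a::{comm_ring,ring_no_zero_divisors} set)"
    and "\<not> homomorphically_finite TYPE('a)"
  shows "\<not> (\<exists>p \<in> beta (UNIV :: 'a set). \<forall>A\<in>p.
           central UNIV (+) A \<and> central (UNIV - {0}) (*) (A - {0}))"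
proof
  assume "\<exists>p \<in> beta (UNIV :: 'a set). \<forall>A\<in>p.
           central UNIV (+) A \<and> central (UNIV - {0}) (*) (A - {0})"
  then obtain p :: "'a set set" where p: "ultrafilter_on UNIV p"
    and add_central: "\<And>A. A \<in> p \<Longrightarrow> central UNIV (+) A"
    and mult_central: "\<And>A. A \<in> p \<Longrightarrow> central (UNIV - {0}) (*) (A - {0})"
    by (auto simp: beta_def)
  obtain r :: 'a where r: "r \<noteq> 0" "\<not> finite_index (ideal_generated r)"
    using assms(2) unfolding homomorphically_finite_def by blast
  define H where "H = ideal_generated r"
  have H: "two_sided_ideal H" "r \<in> H" "\<not> finite_index H"
    using r by (simp_all add: H_def two_sided_ideal_ideal_generated in_ideal_generated)
  show False
  proof (cases "H \<in> p")
    case True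
    then obtain q where "q \<in> K_beta UNIV (+)" "H \<in> q"
      using add_central unfolding central_def EK_beta_def by blast
    then show False
      using K_beta_avoids_infinite_index[of H q] H unfolding two_sided_ideal_def by blast
  next
    case False
    then have "UNIV - H \<in> p" using ultrafilter_on_Diff_iff[OF p] by simp
    then obtain q where q: "q \<in> K_beta (UNIV - {0}) (*)" "UNIV - H - {0} \<in> q"
      using mult_central unfolding central_def EK_beta_def by blast
    have "ultrafilter_on (UNIV - {0}) q \<and> H - {0} \<in> q"
    proof (rule K_beta_contains_ideal[OF _ _ _ _ _ q(1)])
      show "H - {0} \<noteq> {}" using H(2) r(1) by blast
    qed (use H(1) in \<open>auto simp: two_sided_ideal_def\<close>)
    then show False
      using ultrafilter_on_disjoint[of "UNIV - {0}" q "H - {0}" "UNIV - H - {0}"] q(2) by blast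
  qed
qed

end
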